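(* Let $m,n$ be positive integers, let $\mathcal{X}=\{1,\ldots,m\}\times\{1,\ldots,n\}$, and let $\mathcal{P}$ be an $mn$-dimensional linear subspace of the real vector space $\Pi^2$ of bivariate real polynomials. Suppose that $\mathcal{P}$ is a correct space for the DPPM, i.e. for every matrix $A=(a_{ij})\in\mathbb{R}^{m\times n}$ there exists a unique polynomial $p_A\in\mathcal{P}$ with $p_A(i,j)=a_{ij}$ for all $(i,j)\in\mathcal{X}$. Then the map $\mathcal{D}_p:\mathbb{R}^{m\times n}\to\mathcal{P}$ defined by $\mathcal{D}_p(A)=p_A(x,y)$ for all $A\in\mathbb{R}^{m\times n}$ is an isomorphism (of real vector spaces).
   Context: $\Pi^2$ denotes the real vector space of all polynomials in two variables $x,y$ with real coefficients, and $\mathbb{R}^{m\times n}$ the $mn$-dimensional real vector space of $m\times n$ real matrices. The DPPM (Dharm polynomial problem for matrices) is: given $(a_{ij})\in\mathbb{R}^{m\times n}$ and an $mn$-dimensional subspace $\mathcal{P}\subset\Pi^2$, find $p\in\mathcal{P}$ such that $p(i,j)=a_{ij}$ for all $(i,j)\in\mathcal{X}$. The subspace $\mathcal{P}$ is called a correct space for the DPPM if this problem has a unique solution in $\mathcal{P}$ for every matrix $(a_{ij})\in\mathbb{R}^{m\times n}$. *)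

theory Defs
  imports "Jordan_Normal_Form.VS_Connect"
begin

text \<open>A bivariate polynomial is an element of \<open>\<real>[x][y]\<close>: the outer variable is \<open>y\<close>, and
  the coefficients are polynomials in \<open>x\<close>.\<close>

type_synonym bipoly = "real poly poly"

definition eval2 :: "bipoly \<Rightarrow> real \<Rightarrow> real \<Rightarrow> real" where
  "eval2 p x y = poly (poly p [:y:]) x"

text \<open>The fields \<open>mult\<close> and \<open>one\<close> play no role in the vector space structure; they are only there
  because module records extend ring records.\<close>

definition bipoly_space :: "(real, bipoly) module" where
  "bipoly_space =
    \<lparr>carrier = UNIV, mult = (*), one = 1, zero = 0, add = (+),
     smult = (\<lambda>c. Polynomial.smult [:c:])\<rparr>"

abbreviation sub_bipoly_space :: "bipoly set \<Rightarrow> (real, bipoly) module" where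
  "sub_bipoly_space P \<equiv> bipoly_space\<lparr>carrier := P\<rparr>"

abbreviation mat_space :: "nat \<Rightarrow> nat \<Rightarrow> (real, real mat) module" where
  "mat_space m n \<equiv> module_mat TYPE(real) m n"

text \<open>The condition \<open>fin_dim\<close> is needed because \<open>dim\<close> is unspecified for spaces without a finite
  generating set.\<close>

definition has_dim :: "('a, 'c) ring_scheme \<Rightarrow> ('a, 'b, 'd) module_scheme \<Rightarrow> nat \<Rightarrow> bool" where
  "has_dim K V d \<longleftrightarrow> vectorspace.fin_dim K V \<and> vectorspace.dim K V = d"

definition vs_isomorphism ::
  "('a, 'e) ring_scheme \<Rightarrow> ('a, 'b, 'c) module_scheme \<Rightarrow> ('a, 'd, 'f) module_scheme \<Rightarrow>
   ('b \<Rightarrow> 'd) \<Rightarrow> bool" where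
  "vs_isomorphism K V W T \<longleftrightarrow> linear_map K V W T \<and> bij_betw T (carrier V) (carrier W)"

definition grid :: "nat \<Rightarrow> nat \<Rightarrow> (nat \<times> nat) set" where
  "grid m n = {1..m} \<times> {1..n}"

text \<open>Library matrices are indexed from 0, so the entry \<open>a\<^sub>i\<^sub>j\<close> with \<open>1 \<le> i \<le> m\<close>, \<open>1 \<le> j \<le> n\<close>
  is \<open>A $$ (i - 1, j - 1)\<close>.\<close>

definition solves_DPPM :: "nat \<Rightarrow> nat \<Rightarrow> real mat \<Rightarrow> bipoly \<Rightarrow> bool" where
  "solves_DPPM m n A p \<longleftrightarrow>
    (\<forall>(i, j) \<in> grid m n. eval2 p (real i) (real j) = A $$ (i - 1, j - 1))"

definition correct_space :: "nat \<Rightarrow> nat \<Rightarrow> bipoly set \<Rightarrow> bool" where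
  "correct_space m n P \<longleftrightarrow> (\<forall>A \<in> carrier_mat m n. \<exists>!p. p \<in> P \<and> solves_DPPM m n A p)"

definition DPPM_map :: "nat \<Rightarrow> nat \<Rightarrow> bipoly set \<Rightarrow> real mat \<Rightarrow> bipoly" where
  "DPPM_map m n P A = (THE p. p \<in> P \<and> solves_DPPM m n A p)"

lemma vectorspace_bipoly_space: "vectorspace class_ring bipoly_space"
proof -
  have neg: "\<exists>y. x + y = 0" for x :: bipoly
    by (rule exI[of _ "- x"]) simp
  have "field (class_ring :: real ring)"
    by (rule class_field.field_axioms)
  moreover have "abelian_group bipoly_space"
    by unfold_locales
      (auto simp: bipoly_space_def Units_def add.commute add.assoc intro: neg)
  moreover have "module class_ring bipoly_space"
    by (intro moduleI calculation class_cring.cring_axioms)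
      (auto simp: bipoly_space_def smult_add_right smult_add_left[symmetric] mult.commute
        one_pCons[symmetric])
  ultimately show ?thesis
    by (simp add: vectorspace_def)
qed

end

theory Submission
  imports Defs
begin

text \<open>On a correct space \<open>P\<close>, \<open>D\<^sub>p\<close> is the inverse of the evaluation map from \<open>P\<close> to
  matrices: it is linear because sums and multiples of solutions solve the summed and scaled
  problems and solutions are unique.\<close>

lemma vectorspace_mat_space: "vectorspace class_ring (mat_space m n)"
proof -
  have "module class_ring (mat_space m n)"
    by (intro moduleI abelian_group_mat class_cring.cring_axioms)
      (auto simp: module_mat_simps add_smult_distrib_right_mat add_smult_distrib_left_mat
        intro!: eq_matI)
  then show ?thesis
    by (simp add: vectorspace_def class_field.field_axioms)
qed

lemma eval2_add: "eval2 (p + q) x y = eval2 p x y + eval2 q x y"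
  by (simp add: eval2_def)

lemma eval2_smult: "eval2 (Polynomial.smult [:c:] p) x y = c * eval2 p x y"
  by (simp add: eval2_def)

text \<open>Moves the grid to indices from 0, the range of matrix entries, so that the simplifier's
  rules for entries of sums, multiples and \<open>mat\<close> apply directly.\<close>

lemma solves_DPPM_iff:
  "solves_DPPM m n A p \<longleftrightarrow>
    (\<forall>i<m. \<forall>j<n. eval2 p (real (Suc i)) (real (Suc j)) = A $$ (i, j))"
  (is "?lhs \<longleftrightarrow> ?rhs")
proof
  assume ?lhs
  show ?rhs
  proof (intro allI impI)
    fix i j assume "i < m" "j < n"
    then have "(Suc i, Suc j) \<in> grid m n"
      by (auto simp: grid_def)
    then show "eval2 p (real (Suc i)) (real (Suc j)) = A $$ (i, j)"
      using \<open>?lhs\<close> by (force simp: solves_DPPM_def)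
  qed
next
  assume rhs: ?rhs
  show ?lhs
    unfolding solves_DPPM_def
  proof clarify
    fix i j assume "(i, j) \<in> grid m n"
    then show "eval2 p (real i) (real j) = A $$ (i - 1, j - 1)"
      \<comment> \<open>Grid indices are at least 1, so the truncated subtraction loses nothing:
        \<open>Suc (i - 1) = i\<close>, and likewise for \<open>j\<close>.\<close>
      using rhs[rule_format, of "i - 1" "j - 1"] by (auto simp: grid_def)
  qed
qed

lemma solves_DPPM_add:
  assumes "A \<in> carrier_mat m n" "B \<in> carrier_mat m n"
    and "solves_DPPM m n A p" "solves_DPPM m n B q"
  shows "solves_DPPM m n (A + B) (p + q)"
  using assms by (auto simp: solves_DPPM_iff eval2_add)

lemma solves_DPPM_smult:
  assumes "A \<in> carrier_mat m n" "solves_DPPM m n A p"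
  shows "solves_DPPM m n (c \<cdot>\<^sub>m A) (Polynomial.smult [:c:] p)"
  using assms by (auto simp: solves_DPPM_iff eval2_smult)

text \<open>Every entry of the matrix is a value of \<open>p\<close> on the grid. This is the source
  of injectivity.\<close>

lemma solves_DPPM_unique_mat:
  assumes "A \<in> carrier_mat m n" "B \<in> carrier_mat m n"
    and "solves_DPPM m n A p" "solves_DPPM m n B p"
  shows "A = B"
  using assms by (intro eq_matI) (auto simp: solves_DPPM_iff)

text \<open>Supplies the preimage of \<open>p\<close> for surjectivity: its own table of grid
  values.\<close>

lemma solves_DPPM_eval:
  "solves_DPPM m n (mat m n (\<lambda>(i, j). eval2 p (real (Suc i)) (real (Suc j)))) p"
  by (simp add: solves_DPPM_iff)

text \<open>Correctness gives the unique existence that makes the \<open>THE\<close> in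
  \<open>DPPM_map\<close> meaningful.\<close>

lemma DPPM_map_solves:
  assumes "correct_space m n P" "A \<in> carrier_mat m n"
  shows "DPPM_map m n P A \<in> P" and "solves_DPPM m n A (DPPM_map m n P A)"
proof -
  have "\<exists>!p. p \<in> P \<and> solves_DPPM m n A p"
    using assms by (simp add: correct_space_def)
  then show "DPPM_map m n P A \<in> P" and "solves_DPPM m n A (DPPM_map m n P A)"
    unfolding DPPM_map_def by (fact theI'[THEN conjunct1], fact theI'[THEN conjunct2])
qed

text \<open>The form in which uniqueness is used: to compute the map at \<open>A\<close>, it
  suffices to exhibit one solution in \<open>P\<close>.\<close>

lemma DPPM_map_eqI:
  assumes "correct_space m n P" "A \<in> carrier_mat m n" "p \<in> P" "solves_DPPM m n A p"
  shows "DPPM_map m n P A = p"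
  using assms unfolding DPPM_map_def correct_space_def by (intro the1_equality) auto

theorem theorem3p1:
  fixes m n :: nat and P :: "bipoly set"
  assumes "m > 0" and "n > 0"
    and "VectorSpace.subspace class_ring P bipoly_space"
    and "has_dim class_ring (sub_bipoly_space P) (m * n)"
    and "correct_space m n P"
  shows "vs_isomorphism class_ring (mat_space m n) (sub_bipoly_space P) (DPPM_map m n P)"
proof -
  let ?D = "DPPM_map m n P"
  note P = \<open>correct_space m n P\<close>
  note D = DPPM_map_solves[OF P]
  have sub: "submodule class_ring P bipoly_space"
    using assms(3) by (simp add: subspace_def)
  have add_closed: "p + q \<in> P" if "p \<in> P" "q \<in> P" for p q
    using submodule.m_closed[OF sub that] by (simp add: bipoly_space_def)
  have smult_closed: "Polynomial.smult [:c:] p \<in> P" if "p \<in> P" for c p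
    using submodule.smult_closed[OF sub _ that, of c] by (simp add: bipoly_space_def)
  have vsP: "vectorspace class_ring (sub_bipoly_space P)"
    by (rule vectorspace.subspace_is_vs[OF vectorspace_bipoly_space assms(3)])
  \<comment> \<open>The right-hand side lies in \<open>P\<close> and solves the problem for
    \<open>A + B\<close>, so uniqueness identifies it with the left-hand side.\<close>
  have "?D (A + B) = ?D A + ?D B"
    if "A \<in> carrier_mat m n" "B \<in> carrier_mat m n" for A B
    using that by (intro DPPM_map_eqI[OF P] add_closed solves_DPPM_add D) auto
  moreover have "?D (c \<cdot>\<^sub>m A) = Polynomial.smult [:c:] (?D A)"
    if "A \<in> carrier_mat m n" for c A
    using that by (intro DPPM_map_eqI[OF P] smult_closed solves_DPPM_smult D) auto
  ultimately have "?D \<in> LinearCombinations.module_hom class_ring (mat_space m n) (sub_bipoly_space P)"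
    by (auto simp: LinearCombinations.module_hom_def module_mat_simps bipoly_space_def D)
  \<comment> \<open>Beyond the homomorphism property, \<open>linear_map\<close> demands that both
    sides be vector spaces.\<close>
  then have "linear_map class_ring (mat_space m n) (sub_bipoly_space P) ?D"
    using vectorspace_mat_space vsP
    by (simp add: linear_map_def mod_hom_def mod_hom_axioms_def vectorspace_def)
  moreover have "bij_betw ?D (carrier_mat m n) P"
  proof (rule bij_betw_imageI)
    \<comment> \<open>If two matrices have the same image, one polynomial solves both problems, so
      they agree entrywise.\<close>
    show "inj_on ?D (carrier_mat m n)"
      by (rule inj_onI) (metis D(2) solves_DPPM_unique_mat)
    \<comment> \<open>The matrix of grid values of \<open>p\<close> is sent back to
      \<open>p\<close>, since \<open>p\<close> is a solution in \<open>P\<close> for it.\<close>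
    have "p \<in> ?D ` carrier_mat m n" if "p \<in> P" for p
      using DPPM_map_eqI[OF P mat_carrier that solves_DPPM_eval, symmetric]
      by (rule image_eqI) simp
    then show "?D ` carrier_mat m n = P"
      using D(1) by auto
  qed
  ultimately show ?thesis
    by (simp add: vs_isomorphism_def module_mat_simps)
qed

end
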